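(* Let $K$ be the $(p,q)$-torus knot ($p,q$ coprime positive integers), with knot group $G_K=\langle c,d\mid c^p=d^q\rangle$, and let $k,l$ be integers with $0<k<p$, $0<l<q$ and $k\equiv l\pmod 2$. Suppose $\rho:G_K\to SL_2(\mathbb{C})$ is a representation whose conjugacy class $[\rho]$ lies in $\hat R^{\mathrm{irr}}_{k,l}(G_K)$. Then $$\Delta^{\mathrm{Ad}\circ\rho}_{K}(t)=\frac{(t^{pq}-1)^3}{(t^p-1)(t^q-1)\left(t^{2q}-2\left(\cos\frac{2\pi k}{p}\right)t^q+1\right)\left(t^{2p}-2\left(\cos\frac{2\pi l}{q}\right)t^p+1\right)}.$$
   Context: Twisted Alexander polynomial. Let $K$ be a knot in $S^3$ and let $G_K=\pi_1(S^3\setminus K)=\langle a_1,\dots,a_\ell\mid r_1,\dots,r_{\ell-1}\rangle$ be a deficiency-one presentation. Let $f:G_K\to H_1(S^3\setminus K;\mathbb{Z})\cong\mathbb{Z}=\langle t\rangle$ be the abelianization and $\sigma:G_K\to SL_N(\mathbb{C})$ a representation. Let $\Phi:\mathbb{Z}[F_\ell]\to M_N(\mathbb{C}[t^{\pm1}])$ be the ring homomorphism from the group ring of the free group $F_\ell$ on $a_1,\dots,a_\ell$ determined by $g\mapsto f(g)\,\sigma(g)$ for $g\in F_\ell$ (where $g$ is first mapped to $G_K$). Let $M$ be the $(\ell-1)\times\ell$ block matrix whose $(i,j)$ block is $\Phi(\partial r_i/\partial a_j)$, where $\partial/\partial a_j$ is the Fox derivative, and let $M_j$ be $M$ with its $j$-th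 block column removed, regarded as an $N(\ell-1)\times N(\ell-1)$ matrix. Wada's twisted Alexander polynomial is the rational function $$\Delta_K^{\sigma}(t)=\frac{\det M_j}{\det\Phi(1-a_j)},$$ defined up to a factor $t^{Nm}$, $m\in\mathbb{Z}$; equalities between twisted Alexander polynomials and explicit functions are understood with this convention. Adjoint action. For $A\in SL_2(\mathbb{C})$ and $g\in sl_2(\mathbb{C})$, $\mathrm{Ad}_A(g)=AgA^{-1}$. For $\rho:G_K\to SL_2(\mathbb{C})$, the composition $\mathrm{Ad}\circ\rho$ is a representation $G_K\to SL_3(\mathbb{C})$ (after choosing a basis of $sl_2(\mathbb{C})\cong\mathbb{C}^3$), and $\Delta_K^{\mathrm{Ad}\circ\rho}(t)$ is its twisted Alexander polynomial (so $N=3$). Torus knots. For the $(p,q)$-torus knot with $G_K=\langle c,d\mid c^p=d^q\rangle$, the abelianization $f$ sends $c\mapsto t^q$ and $d\mapsto t^p$. Choose natural numbers $r,s$ with $ps-qr=1$; then $\mu=c^{-r}d^s$ is a meridian. A representation $\rho:G_K\to SL_2(\mathbb{C})$ is irreducible if no line in $\mathbb{C}^2$ is invariant under $\rho(G_K)$. For $0<k<p$, $0<l<q$, $k\equiv l\pmod 2$, $\hat R^{\mathrm{irr}}_{k,l}(G_K)$ denotes the component of the set of conjugacy classes of irreducible representations $\rho:G_K\to SL_2(\mathbb{C})$ consisting of those with $\rho(c^p)=\rho(d^q)=(-1)^kI$, $\mathrm{tr}\,\rho(c)=2\cos(\pi k/p)$, $\mathrm{tr}\,\rho(d)=2\cos(\pi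 l/q)$, and $\mathrm{tr}\,\rho(\mu)\ne 2\cos\pi\left(\frac{rk}{p}\pm\frac{sl}{q}\right)$.
   Formalization: Since N=3 is odd, det M_j/det Φ(1−a_j) changes sign with j, so up to t^{3m} alone the polynomial is ill-defined; with relator c^p d^{-q}, the printed formula is proved for the column of c removed, and its negative for the column of d removed. *)

theory Defs
  imports
    Complex_Main
    "HOL-Library.Poly_Mapping"
    "HOL-Computational_Algebra.Polynomial_Factorial"
    "HOL-Algebra.Generated_Groups"
    "HOL-Algebra.Elementary_Groups"
    "Jordan_Normal_Form.Determinant"
begin

section \<open>Free groups, their group rings, and Fox derivatives\<close>

text \<open>A letter \<open>(a, True)\<close> stands for the generator \<open>a\<close> and \<open>(a, False)\<close> for its inverse.\<close>

inductive free_eq :: "('a \<times> bool) list \<Rightarrow> ('a \<times> bool) list \<Rightarrow> bool" where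
  refl: "free_eq u u"
| sym: "free_eq u v \<Longrightarrow> free_eq v u"
| trans: "free_eq u v \<Longrightarrow> free_eq v w \<Longrightarrow> free_eq u w"
| cancel: "free_eq (u @ (a, b) # (a, \<not> b) # v) (u @ v)"

lemma free_eq_context: "free_eq u v \<Longrightarrow> free_eq (x @ u @ y) (x @ v @ y)"
proof (induction rule: free_eq.induct)
  case (cancel u a b v)
  then show ?case using free_eq.cancel[of "x @ u" a b "v @ y"] by simp
qed (auto intro: free_eq.intros)

lemma free_eq_append: "free_eq u u' \<Longrightarrow> free_eq v v' \<Longrightarrow> free_eq (u @ v) (u' @ v')"
  using free_eq_context[of u u' "[]" v] free_eq_context[of v v' u' "[]"]
  by (auto intro: free_eq.trans)

definition inv_word :: "('a \<times> bool) list \<Rightarrow> ('a \<times> bool) list" where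
  "inv_word w = rev (map (\<lambda>(a, b). (a, \<not> b)) w)"

lemma free_eq_inv_word: "free_eq u v \<Longrightarrow> free_eq (inv_word u) (inv_word v)"
proof (induction rule: free_eq.induct)
  case (cancel u a b v)
  then show ?case
    using free_eq.cancel[of "inv_word v" a b "inv_word u"] by (simp add: inv_word_def)
qed (auto intro: free_eq.intros)

lemma free_eq_inv_left: "free_eq (inv_word w @ w) []"
proof (induction w)
  case Nil
  show ?case by (simp add: inv_word_def free_eq.refl)
next
  case (Cons x w)
  obtain a b where x: "x = (a, b)" by (cases x)
  have "free_eq (inv_word w @ (a, \<not> b) # (a, \<not> \<not> b) # w) (inv_word w @ w)"
    by (rule free_eq.cancel)
  with Cons show ?case by (auto simp: x inv_word_def intro: free_eq.trans)
qed

text \<open>The group operation of the free group is written additively, although it is not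
  commutative: the ring structure that \<^theory>\<open>HOL-Library.Poly_Mapping\<close> puts on
  \<open>'a free_group \<Rightarrow>\<^sub>0 int\<close> is then the integral group ring of the free group.\<close>

quotient_type 'a free_group = "('a \<times> bool) list" / free_eq
  by (intro equivpI reflpI sympI transpI) (auto intro: free_eq.intros)

instantiation free_group :: (type) group_add
begin

lift_definition zero_free_group :: "'a free_group" is "[]" .

lift_definition plus_free_group :: "'a free_group \<Rightarrow> 'a free_group \<Rightarrow> 'a free_group"
  is "(@)" by (rule free_eq_append)

lift_definition uminus_free_group :: "'a free_group \<Rightarrow> 'a free_group"
  is inv_word by (rule free_eq_inv_word)

definition minus_free_group :: "'a free_group \<Rightarrow> 'a free_group \<Rightarrow> 'a free_group" where
  "minus_free_group u v = u + (- v)"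

instance
proof
  fix u v w :: "'a free_group"
  show "u + v + w = u + (v + w)" by transfer (simp add: free_eq.refl)
  show "0 + u = u" by transfer (simp add: free_eq.refl)
  show "u + 0 = u" by transfer (simp add: free_eq.refl)
  show "- u + u = 0" by transfer (rule free_eq_inv_left)
  show "u + (- v) = u - v" by (simp add: minus_free_group_def)
qed

end

lift_definition gen :: "'a \<Rightarrow> 'a free_group" is "\<lambda>a. [(a, True)]" .

text \<open>The image of a group element in the integral group ring.\<close>

abbreviation gr_of :: "'a free_group \<Rightarrow> ('a free_group \<Rightarrow>\<^sub>0 int)" where
  "gr_of g \<equiv> Poly_Mapping.single g 1"

fun fox_word :: "'a \<Rightarrow> ('a \<times> bool) list \<Rightarrow> ('a free_group \<Rightarrow>\<^sub>0 int)" where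
  "fox_word a [] = 0"
| "fox_word a ((b, True) # w) = (if b = a then 1 else 0) + gr_of (gen b) * fox_word a w"
| "fox_word a ((b, False) # w) =
     (if b = a then - gr_of (- gen b) else 0) + gr_of (- gen b) * fox_word a w"

lemma abs_free_group_Cons:
  "abs_free_group ((b, True) # w) = gen b + abs_free_group w"
  "abs_free_group ((b, False) # w) = - gen b + abs_free_group w"
  by (simp_all add: gen.abs_eq plus_free_group.abs_eq uminus_free_group.abs_eq inv_word_def)

lemma fox_word_append:
  "fox_word a (u @ v) = fox_word a u + gr_of (abs_free_group u) * fox_word a v"
proof (induction u rule: fox_word.induct[of _ a])
  case (1 a)
  have "abs_free_group [] = (0 :: 'a free_group)" by (simp add: zero_free_group_def)
  then show ?case by simp
qed (simp_all add: abs_free_group_Cons mult_single algebra_simps mult.assoc [symmetric])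

lemma fox_word_free_eq: "free_eq u v \<Longrightarrow> fox_word a u = fox_word a v"
proof (induction rule: free_eq.induct)
  case (cancel u c b v)
  show ?case
    by (cases b)
      (simp_all add: fox_word_append abs_free_group_Cons mult_single algebra_simps
        mult.assoc [symmetric])
qed auto

lift_definition fox :: "'a \<Rightarrow> 'a free_group \<Rightarrow> ('a free_group \<Rightarrow>\<^sub>0 int)" is fox_word
  by (rule fox_word_free_eq)

lemma fox_gen: "fox a (gen b) = (if b = a then 1 else 0)"
  by transfer simp

lemma fox_add: "fox a (u + v) = fox a u + gr_of u * fox a v"
proof -
  obtain x y where "u = abs_free_group x" "v = abs_free_group y"
    by (metis Quotient3_abs_rep Quotient3_free_group)
  then show ?thesis by (simp add: plus_free_group.abs_eq fox.abs_eq fox_word_append)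
qed


section \<open>Groups given by a presentation\<close>

text \<open>The free group on the generators \<open>gen 0, \<dots>, gen (n - 1)\<close>.\<close>

definition free_grp :: "nat \<Rightarrow> nat free_group monoid" where
  "free_grp n = \<lparr>carrier = {abs_free_group w | w. fst ` set w \<subseteq> {..<n}}, monoid.mult = (+), one = 0\<rparr>"

lemma abs_free_group_in_free_grp:
  "fst ` set w \<subseteq> {..<n} \<Longrightarrow> abs_free_group w \<in> carrier (free_grp n)"
  by (auto simp: free_grp_def)

lemma group_free_grp: "group (free_grp n)"
proof (rule groupI)
  fix x y assume "x \<in> carrier (free_grp n)" "y \<in> carrier (free_grp n)"
  then obtain u v where "x = abs_free_group u" "y = abs_free_group v"
    "fst ` set u \<subseteq> {..<n}" "fst ` set v \<subseteq> {..<n}" by (auto simp: free_grp_def)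
  then have "x \<otimes>\<^bsub>free_grp n\<^esub> y = abs_free_group (u @ v)" "fst ` set (u @ v) \<subseteq> {..<n}"
    by (auto simp: free_grp_def plus_free_group.abs_eq)
  then show "x \<otimes>\<^bsub>free_grp n\<^esub> y \<in> carrier (free_grp n)"
    by (metis abs_free_group_in_free_grp)
next
  show "\<one>\<^bsub>free_grp n\<^esub> \<in> carrier (free_grp n)"
    using abs_free_group_in_free_grp[of "[]" n] by (simp add: free_grp_def zero_free_group_def)
next
  fix x assume "x \<in> carrier (free_grp n)"
  then obtain u where u: "x = abs_free_group u" "fst ` set u \<subseteq> {..<n}"
    by (auto simp: free_grp_def)
  have "fst ` set (inv_word u) = fst ` set u"
    by (force simp: inv_word_def image_iff)
  with u have "- x \<in> carrier (free_grp n)"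
    by (simp add: uminus_free_group.abs_eq abs_free_group_in_free_grp)
  moreover have "- x \<otimes>\<^bsub>free_grp n\<^esub> x = \<one>\<^bsub>free_grp n\<^esub>"
    by (simp add: free_grp_def)
  ultimately show "\<exists>y\<in>carrier (free_grp n). y \<otimes>\<^bsub>free_grp n\<^esub> x = \<one>\<^bsub>free_grp n\<^esub>" ..
qed (auto simp: free_grp_def add.assoc)

definition normal_closure :: "('g, 'h) monoid_scheme \<Rightarrow> 'g set \<Rightarrow> 'g set" where
  "normal_closure G R =
     generate G {g \<otimes>\<^bsub>G\<^esub> x \<otimes>\<^bsub>G\<^esub> inv\<^bsub>G\<^esub> g | g x. g \<in> carrier G \<and> x \<in> R}"

definition presented_group :: "nat \<Rightarrow> nat free_group list \<Rightarrow> nat free_group set monoid" where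
  "presented_group n rs = free_grp n Mod normal_closure (free_grp n) (set rs)"

definition pres_class ::
  "nat \<Rightarrow> nat free_group list \<Rightarrow> nat free_group \<Rightarrow> nat free_group set" where
  "pres_class n rs g = normal_closure (free_grp n) (set rs) #>\<^bsub>free_grp n\<^esub> g"


section \<open>Wada's twisted Alexander polynomial\<close>

type_synonym ratfun = "complex poly fract"

definition rat_t :: ratfun where
  "rat_t = to_fract [:0, 1:]"

definition rat_const :: "complex \<Rightarrow> ratfun" where
  "rat_const z = to_fract [:z:]"

text \<open>The \<open>\<int>\<close>-linear extension of \<open>g \<mapsto> t\<^sup>f\<^sup>(\<^sup>g\<^sup>) \<sigma>(g)\<close>, where \<open>f\<close> and \<open>\<sigma>\<close> are maps on the presented
  group.  Its entries are Laurent polynomials, regarded as rational functions.\<close>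

definition wada_Phi ::
  "nat \<Rightarrow> nat \<Rightarrow> nat free_group list \<Rightarrow> (nat free_group set \<Rightarrow> int) \<Rightarrow>
   (nat free_group set \<Rightarrow> complex mat) \<Rightarrow> (nat free_group \<Rightarrow>\<^sub>0 int) \<Rightarrow> ratfun mat" where
  "wada_Phi N n rs f \<sigma> x = mat N N (\<lambda>ij. \<Sum>g\<in>Poly_Mapping.keys x.
     of_int (Poly_Mapping.lookup x g) * rat_t powi f (pres_class n rs g) *
     rat_const (\<sigma> (pres_class n rs g) $$ ij))"

definition wada_M ::
  "nat \<Rightarrow> nat \<Rightarrow> nat free_group list \<Rightarrow> (nat free_group set \<Rightarrow> int) \<Rightarrow>
   (nat free_group set \<Rightarrow> complex mat) \<Rightarrow> ratfun mat" where
  "wada_M N n rs f \<sigma> = mat (N * (n - 1)) (N * n) (\<lambda>(a, b).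
     wada_Phi N n rs f \<sigma> (fox (b div N) (rs ! (a div N))) $$ (a mod N, b mod N))"

definition remove_block_col :: "nat \<Rightarrow> nat \<Rightarrow> 'a mat \<Rightarrow> 'a mat" where
  "remove_block_col N j A = mat (dim_row A) (dim_col A - N)
     (\<lambda>(a, b). A $$ (a, if b < N * j then b else b + N))"

text \<open>The quotient that represents the twisted Alexander polynomial of the presentation with
  generators \<open>gen 0, \<dots>, gen (n - 1)\<close> and \<open>n - 1\<close> relators \<open>rs\<close>, computed by removing the
  block column of \<open>gen j\<close>.  For odd \<open>N\<close> its sign genuinely depends on \<open>j\<close> (moving a block column past
  another one contributes \<open>(-1)\<^sup>N\<close>) and on the orientation of the relators, whereas
  \<open>eq_upto_tN\<close> below only absorbs the factors \<open>t\<^sup>N\<^sup>m\<close>.\<close>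

definition twisted_alexander ::
  "nat \<Rightarrow> nat \<Rightarrow> nat free_group list \<Rightarrow> (nat free_group set \<Rightarrow> int) \<Rightarrow>
   (nat free_group set \<Rightarrow> complex mat) \<Rightarrow> nat \<Rightarrow> ratfun" where
  "twisted_alexander N n rs f \<sigma> j =
     det (remove_block_col N j (wada_M N n rs f \<sigma>)) /
     det (wada_Phi N n rs f \<sigma> (1 - gr_of (gen j)))"

definition eq_upto_tN :: "nat \<Rightarrow> ratfun \<Rightarrow> ratfun \<Rightarrow> bool" where
  "eq_upto_tN N P Q \<longleftrightarrow> (\<exists>m :: int. P = rat_t powi (int N * m) * Q)"


section \<open>Representations and the adjoint action\<close>

definition SL :: "nat \<Rightarrow> complex mat monoid" where
  "SL n = \<lparr>carrier = {A \<in> carrier_mat n n. det A = 1}, monoid.mult = (*), one = 1\<^sub>m n\<rparr>"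

definition mat_trace :: "'a :: comm_monoid_add mat \<Rightarrow> 'a" where
  "mat_trace A = (\<Sum>i<dim_row A. A $$ (i, i))"

definition line_C2 :: "complex vec set \<Rightarrow> bool" where
  "line_C2 L \<longleftrightarrow> (\<exists>v\<in>carrier_vec 2. v \<noteq> 0\<^sub>v 2 \<and> L = {z \<cdot>\<^sub>v v | z. True})"

definition irreducible_rep :: "('g, 'h) monoid_scheme \<Rightarrow> ('g \<Rightarrow> complex mat) \<Rightarrow> bool" where
  "irreducible_rep G \<rho> \<longleftrightarrow>
     \<not> (\<exists>L. line_C2 L \<and> (\<forall>g\<in>carrier G. \<forall>v\<in>L. \<rho> g *\<^sub>v v \<in> L))"

definition conj_class ::
  "('g, 'h) monoid_scheme \<Rightarrow> ('g \<Rightarrow> complex mat) \<Rightarrow> ('g \<Rightarrow> complex mat) set" where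
  "conj_class G \<rho> = {\<rho>' \<in> hom G (SL 2). \<exists>A\<in>carrier (SL 2). \<forall>g\<in>carrier G.
     \<rho>' g = A * \<rho> g * inv\<^bsub>SL 2\<^esub> A}"

definition sl2 :: "complex mat set" where
  "sl2 = {X \<in> carrier_mat 2 2. mat_trace X = 0}"

definition lincomb3 :: "(nat \<Rightarrow> complex mat) \<Rightarrow> complex vec \<Rightarrow> complex mat" where
  "lincomb3 B v = v $ 0 \<cdot>\<^sub>m B 0 + v $ 1 \<cdot>\<^sub>m B 1 + v $ 2 \<cdot>\<^sub>m B 2"

definition sl2_basis :: "(nat \<Rightarrow> complex mat) \<Rightarrow> bool" where
  "sl2_basis B \<longleftrightarrow> (\<forall>i<3. B i \<in> sl2) \<and>
     (\<forall>v\<in>carrier_vec 3. lincomb3 B v = 0\<^sub>m 2 2 \<longrightarrow> v = 0\<^sub>v 3) \<and>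
     (\<forall>X\<in>sl2. \<exists>v\<in>carrier_vec 3. X = lincomb3 B v)"

definition Ad :: "complex mat \<Rightarrow> complex mat \<Rightarrow> complex mat" where
  "Ad A X = A * X * inv\<^bsub>SL 2\<^esub> A"

definition coords :: "(nat \<Rightarrow> complex mat) \<Rightarrow> complex mat \<Rightarrow> complex vec" where
  "coords B X = (THE v. v \<in> carrier_vec 3 \<and> X = lincomb3 B v)"

text \<open>The matrix of \<^const>\<open>Ad\<close> with respect to the basis \<open>B 0, B 1, B 2\<close> of \<^const>\<open>sl2\<close>.\<close>

definition Ad_mat :: "(nat \<Rightarrow> complex mat) \<Rightarrow> complex mat \<Rightarrow> complex mat" where
  "Ad_mat B A = mat 3 3 (\<lambda>(i, j). coords B (Ad A (B j)) $ i)"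


section \<open>Torus knot groups\<close>

text \<open>The presentation \<open>\<langle>c, d | c\<^sup>p = d\<^sup>q\<rangle>\<close> with \<open>c\<close> the generator \<open>0\<close>, \<open>d\<close> the generator \<open>1\<close>, and
  the relation read as the relator \<open>c\<^sup>p d\<^sup>-\<^sup>q\<close>.\<close>

definition torus_rels :: "nat \<Rightarrow> nat \<Rightarrow> nat free_group list" where
  "torus_rels p q =
     [gen 0 [^]\<^bsub>free_grp 2\<^esub> p \<otimes>\<^bsub>free_grp 2\<^esub> inv\<^bsub>free_grp 2\<^esub> (gen 1 [^]\<^bsub>free_grp 2\<^esub> q)]"

definition torus_group :: "nat \<Rightarrow> nat \<Rightarrow> nat free_group set monoid" where
  "torus_group p q = presented_group 2 (torus_rels p q)"

definition torus_c :: "nat \<Rightarrow> nat \<Rightarrow> nat free_group set" where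
  "torus_c p q = pres_class 2 (torus_rels p q) (gen 0)"

definition torus_d :: "nat \<Rightarrow> nat \<Rightarrow> nat free_group set" where
  "torus_d p q = pres_class 2 (torus_rels p q) (gen 1)"

definition torus_meridian :: "nat \<Rightarrow> nat \<Rightarrow> nat \<Rightarrow> nat \<Rightarrow> nat free_group set" where
  "torus_meridian p q r s =
     inv\<^bsub>torus_group p q\<^esub> (torus_c p q [^]\<^bsub>torus_group p q\<^esub> r)
       \<otimes>\<^bsub>torus_group p q\<^esub> (torus_d p q [^]\<^bsub>torus_group p q\<^esub> s)"

definition R_irr ::
  "nat \<Rightarrow> nat \<Rightarrow> nat \<Rightarrow> nat \<Rightarrow> nat \<Rightarrow> nat \<Rightarrow> (nat free_group set \<Rightarrow> complex mat) set set" where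
  "R_irr p q r s k l = {conj_class (torus_group p q) \<rho> | \<rho>.
     \<rho> \<in> hom (torus_group p q) (SL 2) \<and>
     irreducible_rep (torus_group p q) \<rho> \<and>
     \<rho> (torus_c p q [^]\<^bsub>torus_group p q\<^esub> p) = (- 1) ^ k \<cdot>\<^sub>m 1\<^sub>m 2 \<and>
     \<rho> (torus_d p q [^]\<^bsub>torus_group p q\<^esub> q) = (- 1) ^ k \<cdot>\<^sub>m 1\<^sub>m 2 \<and>
     mat_trace (\<rho> (torus_c p q)) = complex_of_real (2 * cos (pi * real k / real p)) \<and>
     mat_trace (\<rho> (torus_d p q)) = complex_of_real (2 * cos (pi * real l / real q)) \<and>
     mat_trace (\<rho> (torus_meridian p q r s)) \<noteq>
       complex_of_real (2 * cos (pi * (real r * real k / real p + real s * real l / real q))) \<and>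
     mat_trace (\<rho> (torus_meridian p q r s)) \<noteq>
       complex_of_real (2 * cos (pi * (real r * real k / real p - real s * real l / real q)))}"

end

theory Submission
  imports Defs
begin

text \<open>For the relator \<open>R = c\<^sup>p d\<^sup>-\<^sup>q\<close> one has \<open>\<partial>R/\<partial>c = 1 + c + \<dots> + c\<^sup>p\<^sup>-\<^sup>1\<close> and
  \<open>\<partial>R/\<partial>d = - R (1 + d + \<dots> + d\<^sup>q\<^sup>-\<^sup>1)\<close>, where \<open>R\<close> acts trivially.  Since \<open>\<rho>(c\<^sup>p) = \<rho>(d\<^sup>q) = \<plusminus>I\<close> acts
  trivially under \<open>Ad\<close>, multiplying these sums by \<open>1 - c\<close> and \<open>1 - d\<close> telescopes to \<open>(1 - t\<^sup>p\<^sup>q) I\<close>, so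
  both numerators are known up to the factors \<open>det \<Phi>(1 - c)\<close> and \<open>det \<Phi>(1 - d)\<close>.  These are values of
  the characteristic polynomial of \<open>Ad A\<close>, whose eigenvalues are \<open>1\<close> and the squares of those of
  \<open>A\<close>: \<open>det (I - x Ad A) = (1 - x) (x\<^sup>2 - ((tr A)\<^sup>2 - 2) x + 1)\<close>.\<close>

section \<open>The adjoint representation\<close>

lemma det_2x2:
  fixes A :: "'a :: comm_ring_1 mat"
  assumes A: "A \<in> carrier_mat 2 2"
  shows "det A = A $$ (0,0) * A $$ (1,1) - A $$ (0,1) * A $$ (1,0)"
proof -
  have det1: "det (mat_delete A i j) = mat_delete A i j $$ (0,0)" for i j
    using A by (intro det_single) (auto simp: mat_delete_def)
  show ?thesis using A
    by (simp add: laplace_expansion_row[OF A, of 0] cofactor_def det1 numeral_2_eq_2)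
       (simp add: mat_delete_def)
qed

lemma det_3x3:
  fixes A :: "'a :: comm_ring_1 mat"
  assumes A: "A \<in> carrier_mat 3 3"
  shows "det A =
    A $$ (0,0) * (A $$ (1,1) * A $$ (2,2) - A $$ (1,2) * A $$ (2,1)) -
    A $$ (0,1) * (A $$ (1,0) * A $$ (2,2) - A $$ (1,2) * A $$ (2,0)) +
    A $$ (0,2) * (A $$ (1,0) * A $$ (2,1) - A $$ (1,1) * A $$ (2,0))"
proof -
  have "mat_delete A i j \<in> carrier_mat 2 2" for i j
    using A by (auto simp: mat_delete_def)
  note det2 = det_2x2[OF this]
  have "{..<3} = {0, 1, 2 :: nat}" by auto
  then show ?thesis using A
    by (simp add: laplace_expansion_row[OF A, of 0] cofactor_def det2)
       (simp add: mat_delete_def numeral_2_eq_2 algebra_simps)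
qed

section \<open>The special linear group and its action on sl2 in standard coordinates\<close>

lemma group_SL: "group (SL n)"
proof (rule groupI)
  fix A assume "A \<in> carrier (SL n)"
  then have A: "A \<in> carrier_mat n n" "det A = 1" by (auto simp: SL_def)
  note adj = adj_mat[OF A(1)]
  \<comment> \<open>For determinant 1 the adjugate is the left inverse; its own determinant is 1 by
    multiplicativity.\<close>
  have "det (adj_mat A * A) = 1" using A(2) adj(3) by simp
  then have "det (adj_mat A) = 1" using A det_mult[OF adj(1) A(1)] by simp
  then have "adj_mat A \<in> carrier (SL n)" "adj_mat A \<otimes>\<^bsub>SL n\<^esub> A = \<one>\<^bsub>SL n\<^esub>"
    using adj A by (auto simp: SL_def)
  then show "\<exists>B\<in>carrier (SL n). B \<otimes>\<^bsub>SL n\<^esub> A = \<one>\<^bsub>SL n\<^esub>" ..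
qed (auto simp: SL_def det_mult)

text \<open>Coordinates in the basis diag(1,-1), E12, E21 of sl2. The entry \<open>(1,1)\<close> is
  omitted, as vanishing trace makes it minus the entry \<open>(0,0)\<close>.\<close>

definition sl2_coords :: "complex mat \<Rightarrow> complex vec" where
  "sl2_coords X = vec_of_list [X $$ (0,0), X $$ (0,1), X $$ (1,0)]"

text \<open>The matrix of \<open>X \<mapsto> A X adj(A)\<close> in these coordinates.  As \<open>adj\<close> reverses products, this action
  is multiplicative for every \<open>A\<close>; for \<open>det A = 1\<close> it is \<open>Ad\<close>.\<close>

definition adj_action :: "'a :: comm_ring_1 mat \<Rightarrow> 'a mat" where
  "adj_action A = (let a = A $$ (0,0); b = A $$ (0,1); c = A $$ (1,0); d = A $$ (1,1)
    in mat 3 3 (\<lambda>(i, j).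
      [[a * d + b * c, - a * c, b * d], [- 2 * a * b, a^2, - (b^2)], [2 * c * d, - (c^2), d^2]] ! i ! j))"

lemma carrier_adj_action [simp]: "adj_action A \<in> carrier_mat 3 3"
  by (simp add: adj_action_def Let_def)

lemma adj_action_mult:
  fixes X Y :: "'a :: comm_ring_1 mat"
  assumes "X \<in> carrier_mat 2 2" "Y \<in> carrier_mat 2 2"
  shows "adj_action (X * Y) = adj_action X * adj_action Y"
  using assms
  by (intro eq_matI)
     (auto simp: adj_action_def Let_def scalar_prod_def numeral_3_eq_3
        numeral_2_eq_2 less_Suc_eq algebra_simps power2_eq_square)

text \<open>If \<open>A\<close> has eigenvalues u and v, the action has eigenvalues uv, u^2 and v^2,
  where u^2 + v^2 = (tr A)^2 - 2 det A. The base is any commutative ring because the formula is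
  later applied over the rational functions, with \<open>x\<close> a power of
  \<open>rat_t\<close>.\<close>

lemma char_adj_action:
  fixes A :: "'a :: comm_ring_1 mat"
  assumes "A \<in> carrier_mat 2 2" "det A = 1"
  shows "det (1\<^sub>m 3 - x \<cdot>\<^sub>m adj_action A) =
    (1 - x) * (x^2 - (mat_trace A ^ 2 - 2) * x + 1)"
proof -
  define a b c d where "a = A $$ (0,0)" "b = A $$ (0,1)" "c = A $$ (1,0)" "d = A $$ (1,1)"
  note abcd = this
  \<comment> \<open>For general \<open>\<delta>\<close> the formula below is a polynomial identity in the entries of \<open>A\<close>.\<close>
  define \<delta> where "\<delta> = a * d - b * c"
  have \<delta>: "\<delta> = 1" using assms det_2x2[of A] by (simp add: abcd \<delta>_def)
  have tr: "mat_trace A = a + d" using assms by (simp add: mat_trace_def abcd numeral_2_eq_2)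
  have car: "1\<^sub>m 3 - x \<cdot>\<^sub>m adj_action A \<in> carrier_mat 3 3"
    by (intro minus_carrier_mat smult_carrier_mat carrier_adj_action)
  have "det (1\<^sub>m 3 - x \<cdot>\<^sub>m adj_action A) =
      (1 - \<delta> * x) * (\<delta>^2 * x^2 - ((a + d)^2 - 2 * \<delta>) * x + 1)"
    unfolding det_3x3[OF car] \<delta>_def
    by (simp add: adj_action_def Let_def abcd[symmetric, simplified])
       (simp add: algebra_simps power2_eq_square)
  then show ?thesis by (simp add: \<delta> tr)
qed

lemma inv_SL2:
  assumes "A \<in> carrier (SL 2)"
  shows "inv\<^bsub>SL 2\<^esub> A = mat 2 2 (\<lambda>(i, j). [[A $$ (1,1), - A $$ (0,1)], [- A $$ (1,0), A $$ (0,0)]] ! i ! j)"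
    (is "_ = ?B")
proof -
  interpret group "SL 2" by (rule group_SL)
  have A: "A \<in> carrier_mat 2 2" "det A = 1" using assms by (auto simp: SL_def)
  have B: "?B \<in> carrier_mat 2 2" by simp
  have d: "A $$ (0,0) * A $$ (1,1) - A $$ (0,1) * A $$ (1,0) = 1"
    using det_2x2[OF A(1)] A(2) by simp
  have "det ?B = 1" using d unfolding det_2x2[OF B] by (simp add: mult.commute)
  moreover have "?B * A = 1\<^sub>m 2"
    using A d by (intro eq_matI)
      (auto simp: scalar_prod_def numeral_2_eq_2 less_Suc_eq algebra_simps)
  ultimately show ?thesis using assms B by (intro inv_equality) (auto simp: SL_def)
qed

text \<open>The inverse is the adjugate, so both claims become polynomial identities in the entries
  of \<open>A\<close> and \<open>X\<close>, with \<open>X $$ (1,1)\<close> eliminated by the trace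
  condition.\<close>

lemma Ad_in_sl2:
  assumes "A \<in> carrier (SL 2)" "X \<in> sl2"
  shows "Ad A X \<in> sl2" and "sl2_coords (Ad A X) = adj_action A *\<^sub>v sl2_coords X"
proof -
  have A: "A \<in> carrier_mat 2 2" "det A = 1" using assms by (auto simp: SL_def)
  have X: "X \<in> carrier_mat 2 2" "X $$ (1,1) = - X $$ (0,0)"
    using assms(2) by (auto simp: sl2_def mat_trace_def numeral_2_eq_2 add_eq_0_iff)
  show "Ad A X \<in> sl2" using A X unfolding Ad_def inv_SL2[OF assms(1)]
    by (auto simp: sl2_def mat_trace_def
        scalar_prod_def numeral_2_eq_2 algebra_simps)
  show "sl2_coords (Ad A X) = adj_action A *\<^sub>v sl2_coords X" using A X unfolding Ad_def inv_SL2[OF assms(1)]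
    by (intro eq_vecI)
       (auto simp: sl2_coords_def adj_action_def Let_def
        scalar_prod_def numeral_2_eq_2 numeral_3_eq_3 less_Suc_eq
        algebra_simps power2_eq_square)
qed

section \<open>Comparison of an arbitrary basis of sl2 with the standard one\<close>

definition basis_change :: "(nat \<Rightarrow> complex mat) \<Rightarrow> complex mat" where
  "basis_change B = mat 3 3 (\<lambda>(i, j). sl2_coords (B j) $ i)"

lemma carrier_basis_change [simp]: "basis_change B \<in> carrier_mat 3 3"
  by (simp add: basis_change_def)

lemma lincomb3_in_sl2:
  assumes "sl2_basis B" "v \<in> carrier_vec 3"
  shows "lincomb3 B v \<in> sl2" and "sl2_coords (lincomb3 B v) = basis_change B *\<^sub>v v"
proof -
  have B: "B i \<in> carrier_mat 2 2" "B i $$ (1,1) = - B i $$ (0,0)" if "i < 3" for i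
    using assms(1) that by (auto simp: sl2_basis_def sl2_def mat_trace_def numeral_2_eq_2 add_eq_0_iff)
  note B' = B[of 0] B[of 1] B[of 2]
  show "lincomb3 B v \<in> sl2" using B'
    by (auto simp: lincomb3_def sl2_def mat_trace_def numeral_2_eq_2)
  show "sl2_coords (lincomb3 B v) = basis_change B *\<^sub>v v" using B' assms(2)
    by (intro eq_vecI)
       (auto simp: sl2_coords_def basis_change_def lincomb3_def scalar_prod_def numeral_2_eq_2
         numeral_3_eq_3 less_Suc_eq algebra_simps)
qed

lemma sl2_coords_eq_0:
  assumes "X \<in> sl2" "sl2_coords X = 0\<^sub>v 3"
  shows "X = 0\<^sub>m 2 2"
proof -
  have "sl2_coords X $ i = 0" if "i < 3" for i using assms(2) that by simp
  from this[of 0] this[of 1] this[of 2] show ?thesis using assms(1)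
    by (intro eq_matI)
       (auto simp: sl2_coords_def sl2_def mat_trace_def numeral_2_eq_2 less_Suc_eq)
qed

text \<open>A nonzero kernel vector would give a nontrivial linear relation among
  \<open>B 0\<close>, \<open>B 1\<close>, \<open>B 2\<close>.\<close>

lemma det_basis_change:
  assumes "sl2_basis B"
  shows "det (basis_change B) \<noteq> 0"
proof
  assume "det (basis_change B) = 0"
  then obtain v where v: "v \<in> carrier_vec 3" "v \<noteq> 0\<^sub>v 3" "basis_change B *\<^sub>v v = 0\<^sub>v 3"
    using det_0_iff_vec_prod_zero[OF carrier_basis_change] by blast
  have "lincomb3 B v = 0\<^sub>m 2 2"
    using lincomb3_in_sl2[OF assms v(1)] v(3) sl2_coords_eq_0 by simp
  then show False using assms v by (auto simp: sl2_basis_def)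
qed

text \<open>As \<open>coords\<close> is a definite description, it must be shown to denote:
  existence holds because \<open>B\<close> spans, uniqueness because \<open>basis_change B\<close>
  has trivial kernel.\<close>

lemma coords_sl2:
  assumes "sl2_basis B" "X \<in> sl2"
  shows "coords B X \<in> carrier_vec 3" and "basis_change B *\<^sub>v coords B X = sl2_coords X"
proof -
  obtain v where v: "v \<in> carrier_vec 3" "X = lincomb3 B v"
    using assms by (auto simp: sl2_basis_def)
  have "w = v" if w: "w \<in> carrier_vec 3" "X = lincomb3 B w" for w
  proof -
    have "basis_change B *\<^sub>v (w - v) = 0\<^sub>v 3"
      using v w lincomb3_in_sl2(2)[OF assms(1)]
      by (simp add: mult_minus_distrib_mat_vec[OF carrier_basis_change])
         (metis carrier_basis_change minus_cancel_vec mult_mat_vec_carrier)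
    then have "w - v = 0\<^sub>v 3"
      using det_basis_change[OF assms(1)] det_0_iff_vec_prod_zero[OF carrier_basis_change] v w
      by (metis minus_carrier_vec)
    then have "(w - v) $ i = 0" if "i < 3" for i using that by simp
    then show "w = v" using v(1) w(1) by (intro eq_vecI) auto
  qed
  then have "coords B X = v" using v unfolding coords_def by (intro the_equality) auto
  then show "coords B X \<in> carrier_vec 3" "basis_change B *\<^sub>v coords B X = sl2_coords X"
    using v lincomb3_in_sl2(2)[OF assms(1) v(1)] by auto
qed

lemma carrier_Ad_mat [simp]: "Ad_mat B A \<in> carrier_mat 3 3"
  by (simp add: Ad_mat_def)

text \<open>Column \<open>j\<close> of either side is the standard coordinate vector of
  \<open>Ad A (B j)\<close>. The similarity of \<open>Ad_mat B A\<close> and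
  \<open>adj_action A\<close> is put as an intertwining relation, which avoids the inverse of
  \<open>basis_change B\<close>.\<close>

lemma basis_change_Ad_mat:
  assumes "sl2_basis B" "A \<in> carrier (SL 2)"
  shows "basis_change B * Ad_mat B A = adj_action A * basis_change B"
proof (rule eq_matI)
  fix i j assume ij: "i < dim_row (adj_action A * basis_change B)"
    "j < dim_col (adj_action A * basis_change B)"
  then have ij: "i < 3" "j < 3" by (simp_all add: basis_change_def carrier_matD[OF carrier_adj_action])
  have Bj: "B j \<in> sl2" using assms(1) ij by (auto simp: sl2_basis_def)
  have AB: "Ad A (B j) \<in> sl2" by (rule Ad_in_sl2[OF assms(2) Bj])
  have "col (Ad_mat B A) j = coords B (Ad A (B j))"
    using ij coords_sl2(1)[OF assms(1) AB] by (intro eq_vecI) (auto simp: Ad_mat_def)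
  then have "(basis_change B * Ad_mat B A) $$ (i, j) = sl2_coords (Ad A (B j)) $ i"
    using ij coords_sl2(2)[OF assms(1) AB, symmetric]
    by (simp add: carrier_matD[OF carrier_Ad_mat] carrier_matD[OF carrier_basis_change])
  also have "\<dots> = (adj_action A *\<^sub>v sl2_coords (B j)) $ i"
    by (simp add: Ad_in_sl2[OF assms(2) Bj])
  also have "sl2_coords (B j) = col (basis_change B) j"
    using ij by (intro eq_vecI) (auto simp: basis_change_def sl2_coords_def)
  also have "(adj_action A *\<^sub>v col (basis_change B) j) $ i = (adj_action A * basis_change B) $$ (i, j)"
    using ij by (simp add: carrier_matD[OF carrier_adj_action] carrier_matD[OF carrier_basis_change])
  finally show "(basis_change B * Ad_mat B A) $$ (i, j) = (adj_action A * basis_change B) $$ (i, j)" .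
qed (simp_all add: carrier_matD[OF carrier_adj_action] carrier_matD[OF carrier_basis_change] carrier_matD[OF carrier_Ad_mat])

text \<open>The adjugate divided by \<open>det P\<close> is a left inverse of \<open>P\<close>, so
  \<open>P * Z\<close> determines \<open>Z\<close>.\<close>

lemma mult_mat_left_cancel:
  fixes P X Y :: "'a :: field mat"
  assumes "P \<in> carrier_mat n n" "det P \<noteq> 0" "X \<in> carrier_mat n m" "Y \<in> carrier_mat n m"
    and "P * X = P * Y"
  shows "X = Y"
proof -
  note adj = adj_mat[OF assms(1)]
  have "Z = inverse (det P) \<cdot>\<^sub>m (adj_mat P * (P * Z))" if "Z \<in> carrier_mat n m" for Z
    using adj that assms(1,2) assoc_mult_mat[OF adj(1) assms(1) that, symmetric]
    by (auto simp: intro!: eq_matI)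
  then show ?thesis using assms by metis
qed

text \<open>Carrying \<open>basis_change B\<close> past one factor at a time reduces this to
  multiplicativity of \<open>adj_action\<close>.\<close>

lemma Ad_mat_mult:
  assumes B: "sl2_basis B" and X: "X \<in> carrier (SL 2)" and Y: "Y \<in> carrier (SL 2)"
  shows "Ad_mat B (X * Y) = Ad_mat B X * Ad_mat B Y"
proof (rule mult_mat_left_cancel[OF carrier_basis_change det_basis_change[OF B]])
  let ?P = "basis_change B"
  have XY: "X * Y \<in> carrier (SL 2)" "X \<in> carrier_mat 2 2" "Y \<in> carrier_mat 2 2"
    using X Y by (auto simp: SL_def det_mult)
  note assoc = assoc_mult_mat[of _ 3 3 _ 3 _ 3]
  have "?P * (Ad_mat B X * Ad_mat B Y) = (?P * Ad_mat B X) * Ad_mat B Y" by (simp add: assoc)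
  also have "\<dots> = adj_action X * (?P * Ad_mat B Y)"
    by (simp add: basis_change_Ad_mat[OF B X] assoc)
  also have "\<dots> = adj_action (X * Y) * ?P"
    by (simp add: basis_change_Ad_mat[OF B Y] adj_action_mult XY assoc)
  also have "\<dots> = ?P * Ad_mat B (X * Y)" by (simp add: basis_change_Ad_mat[OF B XY(1)])
  finally show "?P * Ad_mat B (X * Y) = ?P * (Ad_mat B X * Ad_mat B Y)" ..
qed (rule carrier_Ad_mat mult_carrier_mat[OF carrier_Ad_mat carrier_Ad_mat])+

text \<open>Determinant 1 forces z^2 = 1, and the entries of \<open>adj_action\<close> are quadratic
  in those of the matrix, so the sign of z is lost.\<close>

lemma Ad_mat_scalar:
  assumes B: "sl2_basis B" and "z \<cdot>\<^sub>m 1\<^sub>m 2 \<in> carrier (SL 2)"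
  shows "Ad_mat B (z \<cdot>\<^sub>m 1\<^sub>m 2) = 1\<^sub>m 3"
proof (rule mult_mat_left_cancel[OF carrier_basis_change det_basis_change[OF B]])
  have "z ^ 2 = 1" using assms(2) by (simp add: SL_def)
  then have "adj_action (z \<cdot>\<^sub>m 1\<^sub>m 2) = (1\<^sub>m 3 :: complex mat)"
    by (intro eq_matI)
       (auto simp: adj_action_def Let_def numeral_3_eq_3
         numeral_2_eq_2 less_Suc_eq power2_eq_square)
  then show "basis_change B * Ad_mat B (z \<cdot>\<^sub>m 1\<^sub>m 2) = basis_change B * 1\<^sub>m 3"
    using basis_change_Ad_mat[OF assms] by (simp add: left_mult_one_mat[of _ 3 3] right_mult_one_mat[of _ 3 3])
qed auto

section \<open>Base change from complex numbers to rational functions in t\<close>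

interpretation rat_const_hom: comm_ring_hom rat_const
  by unfold_locales (simp_all add: rat_const_def flip: to_fract_add to_fract_mult one_pCons)

lemmas rat_const_simps =
  rat_const_hom.hom_add rat_const_hom.hom_minus rat_const_hom.hom_uminus rat_const_hom.hom_mult
  rat_const_hom.hom_power rat_const_hom.hom_numeral rat_const_hom.hom_sum

lemma rat_const_eq_0_iff: "rat_const z = 0 \<longleftrightarrow> z = 0"
  by (simp add: rat_const_def)

text \<open>The intertwining relation survives \<open>rat_const\<close> and, \<open>x\<close> being
  a scalar, extends to \<open>?M\<close> and \<open>?N\<close>. Taking determinants and cancelling
  that of the transition matrix leaves the formula for \<open>adj_action\<close>.\<close>

lemma char_Ad_mat:
  assumes B: "sl2_basis B" and A: "A \<in> carrier (SL 2)"
  shows "det (1\<^sub>m 3 - x \<cdot>\<^sub>m map_mat rat_const (Ad_mat B A)) =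
    (1 - x) * (x^2 - rat_const (mat_trace A ^ 2 - 2) * x + 1)"
proof -
  let ?h = "map_mat rat_const" and ?P = "basis_change B"
  let ?M = "1\<^sub>m 3 - x \<cdot>\<^sub>m ?h (Ad_mat B A)" and ?N = "1\<^sub>m 3 - x \<cdot>\<^sub>m ?h (adj_action A)"
  have A2: "A \<in> carrier_mat 2 2" "det A = 1" using A by (auto simp: SL_def)
  have c: "?h ?P \<in> carrier_mat 3 3" "?M \<in> carrier_mat 3 3" "?N \<in> carrier_mat 3 3"
     "?h (Ad_mat B A) \<in> carrier_mat 3 3" "?h (adj_action A) \<in> carrier_mat 3 3"
    by (simp_all add: minus_carrier_mat)
  have "?h ?P * ?h (Ad_mat B A) = ?h (adj_action A) * ?h ?P"
    using basis_change_Ad_mat[OF assms]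
      rat_const_hom.mat_hom_mult[OF carrier_basis_change carrier_Ad_mat]
      rat_const_hom.mat_hom_mult[OF carrier_adj_action carrier_basis_change] by metis
  then have "?h ?P * ?M = ?N * ?h ?P"
    using c(1,4,5) by (simp add: mult_minus_distrib_mat[of _ 3 3 _ 3] minus_mult_distrib_mat[of _ 3 3 _ _ 3]
      mult_smult_distrib[of _ 3 3 _ 3] mult_smult_assoc_mat[of _ 3 3 _ 3] left_mult_one_mat[of _ 3 3] right_mult_one_mat[of _ 3 3])
  then have "det (?h ?P) * det ?M = det ?N * det (?h ?P)" using c by (metis det_mult)
  moreover have "det (?h ?P) \<noteq> 0"
    using det_basis_change[OF B] by (simp add: rat_const_eq_0_iff)
  ultimately have "det ?M = det ?N" by simp
  \<comment> \<open>The entries of \<open>adj_action\<close> are integer polynomials in those of the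
    matrix, hence compatible with ring homomorphisms.\<close>
  also have "?h (adj_action A) = adj_action (?h A)"
    using A2 by (intro eq_matI)
     (auto simp: adj_action_def Let_def numeral_3_eq_3
         numeral_2_eq_2 less_Suc_eq power2_eq_square rat_const_simps)
  also have "det (1\<^sub>m 3 - x \<cdot>\<^sub>m adj_action (?h A)) =
      (1 - x) * (x^2 - (mat_trace (?h A) ^ 2 - 2) * x + 1)"
    using A2 by (intro char_adj_action) auto
  also have "mat_trace (?h A) = rat_const (mat_trace A)"
    using A2 by (simp add: mat_trace_def rat_const_simps)
  finally show ?thesis by (simp add: rat_const_simps)
qed

section \<open>Matrix powers\<close>

text \<open>Telescoping, by induction on \<open>m\<close>. The sum is formed entry by entry because
  \<open>wada_Phi_sum\<close> delivers it in that shape.\<close>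

lemma geometric_mat_sum:
  fixes A :: "'a :: comm_ring_1 mat"
  assumes A: "A \<in> carrier_mat n n"
  shows "mat n n (\<lambda>ij. \<Sum>i<m. (A ^\<^sub>m i) $$ ij) * (1\<^sub>m n - A) = 1\<^sub>m n - A ^\<^sub>m m"
proof (induction m)
  case 0
  then show ?case using A by (auto intro!: eq_matI simp: scalar_prod_def)
next
  case (Suc m)
  let ?S = "\<lambda>m. mat n n (\<lambda>ij. \<Sum>i<m. (A ^\<^sub>m i) $$ ij)"
  have p: "A ^\<^sub>m m \<in> carrier_mat n n" using A by simp
  have "?S (Suc m) = ?S m + A ^\<^sub>m m" using carrier_matD[OF p]
    by (intro eq_matI) (auto simp del: pow_mat.simps pow_mat_dim pow_mat_dim_square)
  then have "?S (Suc m) * (1\<^sub>m n - A) = (1\<^sub>m n - A ^\<^sub>m m) + A ^\<^sub>m m * (1\<^sub>m n - A)"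
    using A p by (simp add: add_mult_distrib_mat[of _ n n _ _ n] minus_carrier_mat Suc.IH)
  also have "\<dots> = 1\<^sub>m n - A ^\<^sub>m Suc m"
    using A p by (simp add: mult_minus_distrib_mat[of _ n n _ n]) (intro eq_matI, auto)
  finally show ?case .
qed

lemma pow_mat_smult:
  fixes A :: "'a :: comm_ring_1 mat"
  assumes A: "A \<in> carrier_mat n n"
  shows "(x \<cdot>\<^sub>m A) ^\<^sub>m m = x ^ m \<cdot>\<^sub>m (A ^\<^sub>m m)"
proof (induction m)
  case (Suc m)
  have p: "A ^\<^sub>m m \<in> carrier_mat n n" using A by simp
  show ?case using A p by (simp add: Suc.IH mult_smult_distrib[of _ n n _ n] mult_smult_assoc_mat[of _ n n _ n])
      (auto intro!: eq_matI simp: algebra_simps)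
qed (use A in \<open>auto intro!: eq_matI\<close>)

lemma det_one_minus_smult_one: "det (1\<^sub>m n - x \<cdot>\<^sub>m 1\<^sub>m n) = (1 - x) ^ n" for x :: "'a :: comm_ring_1"
proof -
  have "1\<^sub>m n - x \<cdot>\<^sub>m 1\<^sub>m n = (1 - x) \<cdot>\<^sub>m (1\<^sub>m n :: 'a mat)"
    by (auto intro!: eq_matI)
  then show ?thesis by simp
qed

section \<open>Presentations and Fox calculus\<close>

text \<open>A conjugate of a conjugate of a relator is again one, so the generating set is stable
  under conjugation.\<close>

lemma normal_normal_closure:
  fixes G (structure)
  assumes "group G" "R \<subseteq> carrier G"
  shows "normal_closure G R \<lhd> G"
proof -
  interpret group G by fact
  let ?H = "{g \<otimes> x \<otimes> inv g | g x. g \<in> carrier G \<and> x \<in> R}"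
  show ?thesis unfolding normal_closure_def
  proof (rule normal_generateI)
    show "?H \<subseteq> carrier G" using assms(2) by auto
  next
    fix h g assume h: "h \<in> ?H" and g: "g \<in> carrier G"
    from h obtain k x where k: "k \<in> carrier G" "x \<in> R" "h = k \<otimes> x \<otimes> inv k" by auto
    then have "x \<in> carrier G" using assms(2) by auto
    then have "g \<otimes> h \<otimes> inv g = (g \<otimes> k) \<otimes> x \<otimes> inv (g \<otimes> k)"
      using k g by (simp add: m_assoc inv_mult_group)
    then show "g \<otimes> h \<otimes> inv g \<in> ?H" using k g by blast
  qed
qed

lemma subset_normal_closure:
  fixes G (structure)
  assumes "group G" "R \<subseteq> carrier G"
  shows "R \<subseteq> normal_closure G R"
proof
  fix x assume x: "x \<in> R"
  interpret group G by fact
  have "x = \<one> \<otimes> x \<otimes> inv \<one>" using x assms(2) by auto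
  then show "x \<in> normal_closure G R"
    unfolding normal_closure_def using x by (blast intro: generate.incl)
qed

context
  fixes n :: nat and rs :: "nat free_group list"
  assumes rs: "set rs \<subseteq> carrier (free_grp n)"
begin

lemma group_presented_group: "group (presented_group n rs)"
  unfolding presented_group_def
  by (rule normal.factorgroup_is_group[OF normal_normal_closure[OF group_free_grp rs]])

lemma pres_class_hom: "pres_class n rs \<in> hom (free_grp n) (presented_group n rs)"
  using normal.r_coset_hom_Mod[OF normal_normal_closure[OF group_free_grp rs]]
  unfolding presented_group_def pres_class_def[abs_def] .

lemma group_hom_pres_class: "group_hom (free_grp n) (presented_group n rs) (pres_class n rs)"
  by (simp add: group_hom_def group_hom_axioms_def group_free_grp group_presented_group pres_class_hom)

lemma pres_class_relator:
  assumes "r \<in> set rs"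
  shows "pres_class n rs r = \<one>\<^bsub>presented_group n rs\<^esub>"
proof -
  interpret normal "normal_closure (free_grp n) (set rs)" "free_grp n"
    by (rule normal_normal_closure[OF group_free_grp rs])
  have "r \<in> normal_closure (free_grp n) (set rs)"
    using assms subset_normal_closure[OF group_free_grp rs] by blast
  then show ?thesis by (simp add: pres_class_def presented_group_def rcos_const)
qed

text \<open>This will absorb the left factor \<open>R\<close> that the product rule leaves in the
  Fox derivative by d.\<close>

lemma pres_class_relator_add:
  assumes "r \<in> set rs" "g \<in> carrier (free_grp n)"
  shows "pres_class n rs (r + g) = pres_class n rs g"
proof -
  interpret group_hom "free_grp n" "presented_group n rs" "pres_class n rs"
    by (rule group_hom_pres_class)
  have "pres_class n rs (r \<otimes>\<^bsub>free_grp n\<^esub> g) = pres_class n rs g"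
    using assms rs by (subst hom_mult) (auto simp: pres_class_relator)
  then show ?thesis by (simp add: free_grp_def)
qed

end

lemma gen_in_free_grp: "b < n \<Longrightarrow> gen b \<in> carrier (free_grp n)"
  using abs_free_group_in_free_grp[of "[(b, True)]" n] by (simp add: gen.abs_eq)

lemma mult_free_grp [simp]: "x \<otimes>\<^bsub>free_grp n\<^esub> y = x + y"
  and one_free_grp [simp]: "\<one>\<^bsub>free_grp n\<^esub> = 0"
  by (simp_all add: free_grp_def)

lemma inv_free_grp:
  assumes "x \<in> carrier (free_grp n)"
  shows "inv\<^bsub>free_grp n\<^esub> x = - x"
proof -
  interpret group "free_grp n" by (rule group_free_grp)
  have "inv\<^bsub>free_grp n\<^esub> x + x = 0" using l_inv[OF assms] by simp
  then show ?thesis by (simp add: eq_neg_iff_add_eq_0)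
qed

lemma fox_zero: "fox a 0 = 0"
  using fox_add[of a 0 0] by (simp add: single_one flip: one_poly_mapping_def)

text \<open>The product rule applied to \<open>- u + u = 0\<close>.\<close>

lemma fox_uminus: "fox a (- u) = - gr_of (- u) * fox a u"
  using fox_add[of a "- u" u] by (simp add: fox_zero eq_neg_iff_add_eq_0)

lemma fox_gen_pow:
  fixes m :: nat
  shows "fox a (gen b [^]\<^bsub>free_grp n\<^esub> m) = (if b = a then \<Sum>i<m. gr_of (gen b [^]\<^bsub>free_grp n\<^esub> i) else 0)"
  by (induction m) (simp_all add: fox_zero fox_add fox_gen)

section \<open>The map \<open>\<Phi>\<close>\<close>

text \<open>Coefficients may cancel, so \<open>x + y\<close> can have fewer keys than the union; the
  missing terms have coefficient 0. This makes \<Phi> additive.\<close>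

lemma sum_keys_add:
  fixes h :: "'g \<Rightarrow> 'r :: ring_1"
  shows "(\<Sum>g\<in>Poly_Mapping.keys (x + y). of_int (Poly_Mapping.lookup (x + y) g) * h g) =
    (\<Sum>g\<in>Poly_Mapping.keys x. of_int (Poly_Mapping.lookup x g) * h g) +
    (\<Sum>g\<in>Poly_Mapping.keys y. of_int (Poly_Mapping.lookup y g) * h g)"
  using setsum_keys_plus_distrib[of "\<lambda>g n. of_int n * h g" x y]
  by (simp add: distrib_right)

lemma wada_Phi_carrier [simp]: "wada_Phi N n rs f \<sigma> x \<in> carrier_mat N N"
  by (simp add: wada_Phi_def)

lemma wada_Phi_dim [simp]:
  "dim_row (wada_Phi N n rs f \<sigma> x) = N" "dim_col (wada_Phi N n rs f \<sigma> x) = N"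
  by (simp_all add: wada_Phi_def)

lemma wada_Phi_add: "wada_Phi N n rs f \<sigma> (x + y) = wada_Phi N n rs f \<sigma> x + wada_Phi N n rs f \<sigma> y"
  by (intro eq_matI) (simp_all add: wada_Phi_def mult.assoc sum_keys_add)

lemma wada_Phi_zero: "wada_Phi N n rs f \<sigma> 0 = 0\<^sub>m N N"
  by (intro eq_matI) (simp_all add: wada_Phi_def)

lemma wada_Phi_uminus: "wada_Phi N n rs f \<sigma> (- x) = - wada_Phi N n rs f \<sigma> x"
  by (intro eq_matI) (simp_all add: wada_Phi_def keys_minus sum_negf)

lemma wada_Phi_diff: "wada_Phi N n rs f \<sigma> (x - y) = wada_Phi N n rs f \<sigma> x - wada_Phi N n rs f \<sigma> y"
  using wada_Phi_add[of N n rs f \<sigma> x "- y"] by (simp add: wada_Phi_uminus) (auto intro!: eq_matI)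

lemma wada_Phi_sum:
  fixes m :: nat
  shows "wada_Phi N n rs f \<sigma> (\<Sum>i<m. x i) = mat N N (\<lambda>ij. \<Sum>i<m. wada_Phi N n rs f \<sigma> (x i) $$ ij)"
proof (induction m)
  case (Suc m)
  then show ?case by (intro eq_matI) (simp_all add: wada_Phi_add)
qed (auto simp: wada_Phi_zero intro!: eq_matI)

lemma wada_Phi_gr_of:
  assumes "\<sigma> (pres_class n rs g) \<in> carrier_mat N N"
  shows "wada_Phi N n rs f \<sigma> (gr_of g) =
    rat_t powi f (pres_class n rs g) \<cdot>\<^sub>m map_mat rat_const (\<sigma> (pres_class n rs g))"
  using assms by (intro eq_matI) (simp_all add: wada_Phi_def)

text \<open>Apart from sign and a left factor \<open>R\<close>, the Fox derivatives of the torus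
  relator are sums of powers of one generator, so these values and additivity determine \<Phi>
  there.\<close>

lemma wada_Phi_gen_pow:
  assumes rs: "set rs \<subseteq> carrier (free_grp n)"
    and f: "f \<in> hom (presented_group n rs) integer_group"
    and \<sigma>: "\<And>x. x \<in> carrier (presented_group n rs) \<Longrightarrow> \<sigma> x \<in> carrier_mat N N"
    and \<sigma>_one: "\<sigma> \<one>\<^bsub>presented_group n rs\<^esub> = 1\<^sub>m N"
    and \<sigma>_mult: "\<And>x y. x \<in> carrier (presented_group n rs) \<Longrightarrow> y \<in> carrier (presented_group n rs) \<Longrightarrow>
      \<sigma> (x \<otimes>\<^bsub>presented_group n rs\<^esub> y) = \<sigma> x * \<sigma> y"
    and b: "b < n" and e: "f (pres_class n rs (gen b)) = int e"
  shows "wada_Phi N n rs f \<sigma> (gr_of (gen b [^]\<^bsub>free_grp n\<^esub> i)) =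
      (rat_t ^ e \<cdot>\<^sub>m map_mat rat_const (\<sigma> (pres_class n rs (gen b)))) ^\<^sub>m i"
    and "\<sigma> (pres_class n rs (gen b) [^]\<^bsub>presented_group n rs\<^esub> i) = \<sigma> (pres_class n rs (gen b)) ^\<^sub>m i"
proof -
  interpret \<pi>: group_hom "free_grp n" "presented_group n rs" "pres_class n rs"
    by (rule group_hom_pres_class[OF rs])
  interpret f: group_hom "presented_group n rs" integer_group f
    by (simp add: group_hom_def group_hom_axioms_def f)
  let ?c = "pres_class n rs (gen b)"
  have gen: "gen b \<in> carrier (free_grp n)" by (rule gen_in_free_grp[OF b])
  have c: "?c \<in> carrier (presented_group n rs)" by (rule \<pi>.hom_closed[OF gen])
  show \<sigma>_pow: "\<sigma> (?c [^]\<^bsub>presented_group n rs\<^esub> i) = \<sigma> ?c ^\<^sub>m i"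
    using c \<sigma>[OF c] by (induction i) (simp_all add: \<sigma>_one \<sigma>_mult)
  have f_pow: "f (?c [^]\<^bsub>presented_group n rs\<^esub> i) = int (e * i)"
    using c e by (simp add: f.hom_nat_pow)
  have "wada_Phi N n rs f \<sigma> (gr_of (gen b [^]\<^bsub>free_grp n\<^esub> i)) =
      rat_t ^ (e * i) \<cdot>\<^sub>m map_mat rat_const (\<sigma> ?c ^\<^sub>m i)"
    using \<sigma>[of "?c [^]\<^bsub>presented_group n rs\<^esub> i"] c
    by (simp add: wada_Phi_gr_of \<pi>.hom_nat_pow[OF gen] \<sigma>_pow f_pow power_int_of_nat del: of_nat_mult)
  then show "wada_Phi N n rs f \<sigma> (gr_of (gen b [^]\<^bsub>free_grp n\<^esub> i)) =
      (rat_t ^ e \<cdot>\<^sub>m map_mat rat_const (\<sigma> ?c)) ^\<^sub>m i"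
    using \<sigma>[OF c] by (simp add: pow_mat_smult[of _ N] rat_const_hom.mat_hom_pow[of _ N] power_mult)
qed

text \<open>With two generators and one relator the matrix is a row of two blocks, and the surviving
  block has index \<open>1 - j\<close>.\<close>

lemma remove_block_col_wada_M:
  assumes "j < 2" "N > 0"
  shows "remove_block_col N j (wada_M N 2 [r] f \<sigma>) = wada_Phi N 2 [r] f \<sigma> (fox (1 - j) r)"
proof -
  consider "j = 0" | "j = 1" using assms by linarith
  then show ?thesis using assms(2)
    by cases (auto intro!: eq_matI simp: remove_block_col_def wada_M_def div_add_self2)
qed

section \<open>Torus knot groups\<close>

lemma mat_trace_mult_commute:
  fixes X Y :: "'a :: comm_semiring_0 mat"
  assumes "X \<in> carrier_mat n m" "Y \<in> carrier_mat m n"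
  shows "mat_trace (X * Y) = mat_trace (Y * X)"
proof -
  have "mat_trace (X * Y) = (\<Sum>i<n. \<Sum>j<m. X $$ (i, j) * Y $$ (j, i))"
    using assms by (simp add: mat_trace_def scalar_prod_def lessThan_atLeast0)
  also have "\<dots> = (\<Sum>j<m. \<Sum>i<n. Y $$ (j, i) * X $$ (i, j))"
    by (subst sum.swap) (simp add: mult.commute)
  also have "\<dots> = mat_trace (Y * X)"
    using assms by (simp add: mat_trace_def scalar_prod_def lessThan_atLeast0)
  finally show ?thesis .
qed

lemma SL_conj:
  assumes A: "A \<in> carrier (SL n)" and X: "X \<in> carrier_mat n n"
  shows "mat_trace (A * X * inv\<^bsub>SL n\<^esub> A) = mat_trace X"
    and "A * (z \<cdot>\<^sub>m 1\<^sub>m n) * inv\<^bsub>SL n\<^esub> A = z \<cdot>\<^sub>m 1\<^sub>m n"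
proof -
  interpret group "SL n" by (rule group_SL)
  have carr: "A \<in> carrier_mat n n" "inv\<^bsub>SL n\<^esub> A \<in> carrier_mat n n"
    and inv: "inv\<^bsub>SL n\<^esub> A * A = 1\<^sub>m n" "A * inv\<^bsub>SL n\<^esub> A = 1\<^sub>m n"
    using A inv_closed[OF A] l_inv[OF A] r_inv[OF A] by (auto simp: SL_def)
  have "mat_trace (A * X * inv\<^bsub>SL n\<^esub> A) = mat_trace (inv\<^bsub>SL n\<^esub> A * (A * X))"
    using carr X by (intro mat_trace_mult_commute) auto
  also have "inv\<^bsub>SL n\<^esub> A * (A * X) = X"
    using carr X inv assoc_mult_mat[OF carr(2,1) X] by simp
  finally show "mat_trace (A * X * inv\<^bsub>SL n\<^esub> A) = mat_trace X" .
  show "A * (z \<cdot>\<^sub>m 1\<^sub>m n) * inv\<^bsub>SL n\<^esub> A = z \<cdot>\<^sub>m 1\<^sub>m n"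
    using carr inv by (simp add: mult_smult_distrib[of _ n n _ n] mult_smult_assoc_mat[of _ n n _ n])
qed

text \<open>Membership in \<open>R_irr\<close> gives the conditions for some representative of the
  class. Conjugation by the identity puts \<rho> into its own class, so it is conjugate to that
  representative, and traces and scalar matrices are invariant under conjugation.\<close>

lemma R_irrD:
  assumes \<rho>: "\<rho> \<in> hom (torus_group p q) (SL 2)" and grp: "group (torus_group p q)"
    and R: "conj_class (torus_group p q) \<rho> \<in> R_irr p q r s k l"
    and c: "torus_c p q \<in> carrier (torus_group p q)" and d: "torus_d p q \<in> carrier (torus_group p q)"
  shows "\<rho> (torus_c p q [^]\<^bsub>torus_group p q\<^esub> p) = (- 1) ^ k \<cdot>\<^sub>m 1\<^sub>m 2"
    and "\<rho> (torus_d p q [^]\<^bsub>torus_group p q\<^esub> q) = (- 1) ^ k \<cdot>\<^sub>m 1\<^sub>m 2"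
    and "mat_trace (\<rho> (torus_c p q)) = complex_of_real (2 * cos (pi * real k / real p))"
    and "mat_trace (\<rho> (torus_d p q)) = complex_of_real (2 * cos (pi * real l / real q))"
proof -
  let ?G = "torus_group p q"
  interpret G: group ?G by fact
  interpret SL: group "SL 2" by (rule group_SL)
  obtain \<rho>' where eq: "conj_class ?G \<rho> = conj_class ?G \<rho>'" and \<rho>': "\<rho>' \<in> hom ?G (SL 2)"
    "\<rho>' (torus_c p q [^]\<^bsub>?G\<^esub> p) = (- 1) ^ k \<cdot>\<^sub>m 1\<^sub>m 2"
    "\<rho>' (torus_d p q [^]\<^bsub>?G\<^esub> q) = (- 1) ^ k \<cdot>\<^sub>m 1\<^sub>m 2"
    "mat_trace (\<rho>' (torus_c p q)) = complex_of_real (2 * cos (pi * real k / real p))"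
    "mat_trace (\<rho>' (torus_d p q)) = complex_of_real (2 * cos (pi * real l / real q))"
    using R unfolding R_irr_def by blast
  have "\<rho> \<in> conj_class ?G \<rho>"
    unfolding conj_class_def
  proof (intro CollectI conjI \<rho> bexI[of _ "\<one>\<^bsub>SL 2\<^esub>"] ballI)
    fix g assume "g \<in> carrier ?G"
    then have "\<rho> g \<in> carrier (SL 2)" using \<rho> by (auto simp: hom_def)
    then have "\<rho> g = \<one>\<^bsub>SL 2\<^esub> \<otimes>\<^bsub>SL 2\<^esub> \<rho> g \<otimes>\<^bsub>SL 2\<^esub> inv\<^bsub>SL 2\<^esub> \<one>\<^bsub>SL 2\<^esub>" by simp
    then show "\<rho> g = \<one>\<^bsub>SL 2\<^esub> * \<rho> g * inv\<^bsub>SL 2\<^esub> \<one>\<^bsub>SL 2\<^esub>" by (simp add: SL_def)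
  qed simp
  then obtain A where A: "A \<in> carrier (SL 2)"
    and conj: "\<And>g. g \<in> carrier ?G \<Longrightarrow> \<rho> g = A * \<rho>' g * inv\<^bsub>SL 2\<^esub> A"
    unfolding eq by (auto simp: conj_class_def)
  have "\<rho>' g \<in> carrier_mat 2 2" if "g \<in> carrier ?G" for g
    using \<rho>'(1) that by (auto simp: hom_def SL_def)
  note SL_conj = SL_conj[OF A this]
  show "\<rho> (torus_c p q [^]\<^bsub>?G\<^esub> p) = (- 1) ^ k \<cdot>\<^sub>m 1\<^sub>m 2"
       "\<rho> (torus_d p q [^]\<^bsub>?G\<^esub> q) = (- 1) ^ k \<cdot>\<^sub>m 1\<^sub>m 2"
    using c d SL_conj(2)[OF c] \<rho>'(2,3) by (simp_all add: conj)
  show "mat_trace (\<rho> (torus_c p q)) = complex_of_real (2 * cos (pi * real k / real p))"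
       "mat_trace (\<rho> (torus_d p q)) = complex_of_real (2 * cos (pi * real l / real q))"
    using SL_conj(1) c d \<rho>'(4,5) by (simp_all add: conj)
qed

lemma rat_t_power: "rat_t ^ n = to_fract (monom 1 n)"
  by (induction n) (simp_all add: rat_t_def monom_Suc flip: to_fract_mult)

text \<open>By the degree of the monomial. This later shows that the denominators do not
  vanish.\<close>

lemma rat_t_power_neq_1: "n > 0 \<Longrightarrow> rat_t ^ n \<noteq> 1"
  by (metis rat_t_power to_fract_1 to_fract_eq_iff degree_monom_eq degree_1 one_neq_zero less_irrefl)

theorem theorem2p3:
  fixes p q r s k l :: nat
    and \<rho> :: "nat free_group set \<Rightarrow> complex mat"
    and f :: "nat free_group set \<Rightarrow> int"
    and B :: "nat \<Rightarrow> complex mat"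
  assumes "p > 0" and "q > 0" and "coprime p q"
    and "int p * int s - int q * int r = 1"
    and "0 < k" and "k < p" and "0 < l" and "l < q" and "k mod 2 = l mod 2"
    and "f \<in> hom (torus_group p q) integer_group"
    and "f (torus_c p q) = int q" and "f (torus_d p q) = int p"
    and "\<rho> \<in> hom (torus_group p q) (SL 2)"
    and "conj_class (torus_group p q) \<rho> \<in> R_irr p q r s k l"
    and "sl2_basis B"
  shows "let \<Delta> = twisted_alexander 3 2 (torus_rels p q) f (Ad_mat B \<circ> \<rho>);
      F = (rat_t ^ (p * q) - 1) ^ 3 /
        ((rat_t ^ p - 1) * (rat_t ^ q - 1) *
         (rat_t ^ (2 * q)
            - rat_const (complex_of_real (2 * cos (2 * pi * real k / real p))) * rat_t ^ q + 1) *
         (rat_t ^ (2 * p)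
            - rat_const (complex_of_real (2 * cos (2 * pi * real l / real q))) * rat_t ^ p + 1))
    in eq_upto_tN 3 (\<Delta> 0) F \<and> eq_upto_tN 3 (\<Delta> 1) (- F)"
proof -

  \<comment> \<open>Set-up: the relator, the adjoint representation and powers of the
    generators\<close>
  let ?Fr = "free_grp 2" and ?G = "torus_group p q" and ?c = "torus_c p q" and ?d = "torus_d p q"
  \<comment> \<open>Subtraction in the additively written free group appends the inverse on the
    right, so this is c^p d^-q.\<close>
  define R where "R = gen 0 [^]\<^bsub>?Fr\<^esub> p - gen 1 [^]\<^bsub>?Fr\<^esub> q"
  define \<sigma> where "\<sigma> = Ad_mat B \<circ> \<rho>"
  define h where "h = map_mat rat_const"
  define \<Phi> where "\<Phi> = wada_Phi 3 2 [R] f \<sigma>"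
  interpret Fr: group ?Fr by (rule group_free_grp)
  have gen: "gen 0 \<in> carrier ?Fr" "gen 1 \<in> carrier ?Fr" by (simp_all add: gen_in_free_grp)
  have rels: "torus_rels p q = [R]"
    using gen by (simp add: torus_rels_def R_def inv_free_grp)
  have R: "R \<in> carrier ?Fr"
  proof -
    have "gen 0 [^]\<^bsub>?Fr\<^esub> p \<otimes>\<^bsub>?Fr\<^esub> inv\<^bsub>?Fr\<^esub> (gen 1 [^]\<^bsub>?Fr\<^esub> q) \<in> carrier ?Fr"
      using gen by (intro Fr.m_closed Fr.inv_closed Fr.nat_pow_closed)
    then show ?thesis using gen by (simp add: R_def inv_free_grp)
  qed
  then have rs: "set [R] \<subseteq> carrier ?Fr" by simp
  have G: "?G = presented_group 2 [R]" by (simp add: torus_group_def rels)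
  have c: "?c = pres_class 2 [R] (gen 0)" and d: "?d = pres_class 2 [R] (gen 1)"
    by (simp_all add: torus_c_def torus_d_def rels)
  interpret G: group ?G unfolding G by (rule group_presented_group[OF rs])
  interpret SL: group "SL 2" by (rule group_SL)
  interpret \<rho>: group_hom ?G "SL 2" \<rho>
    by (simp add: group_hom_def group_hom_axioms_def G.is_group SL.is_group assms)
  have cd_in: "?c \<in> carrier ?G" "?d \<in> carrier ?G"
    unfolding c d G using gen group_hom.hom_closed[OF group_hom_pres_class[OF rs]] by blast+
  note \<rho>_cd = R_irrD[OF assms(13) G.is_group assms(14) cd_in]
  note basis = \<open>sl2_basis B\<close>
  have \<sigma>_carrier: "\<sigma> x \<in> carrier_mat 3 3" for x by (simp add: \<sigma>_def)
  have one_SL: "\<one>\<^bsub>SL 2\<^esub> = (1 :: complex) \<cdot>\<^sub>m 1\<^sub>m 2" by (auto simp: SL_def)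
  have \<sigma>_one: "\<sigma> \<one>\<^bsub>?G\<^esub> = 1\<^sub>m 3"
    using Ad_mat_scalar[OF basis, of 1] SL.one_closed by (simp add: \<sigma>_def one_SL)
  have \<sigma>_mult: "\<sigma> (x \<otimes>\<^bsub>?G\<^esub> y) = \<sigma> x * \<sigma> y" if "x \<in> carrier ?G" "y \<in> carrier ?G" for x y
    using Ad_mat_mult[OF basis \<rho>.hom_closed[OF that(1)] \<rho>.hom_closed[OF that(2)]]
      \<rho>.hom_mult[OF that] by (simp add: \<sigma>_def) (simp add: SL_def)
  have pow: "\<Phi> (gr_of (gen b [^]\<^bsub>?Fr\<^esub> i)) = (rat_t ^ e \<cdot>\<^sub>m h (\<sigma> (pres_class 2 [R] (gen b)))) ^\<^sub>m i"
      "\<sigma> (pres_class 2 [R] (gen b) [^]\<^bsub>?G\<^esub> i) = \<sigma> (pres_class 2 [R] (gen b)) ^\<^sub>m i"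
    if "b < 2" "f (pres_class 2 [R] (gen b)) = int e" for b e and i :: nat
    using wada_Phi_gen_pow[OF rs, folded G h_def, OF assms(10) \<sigma>_carrier \<sigma>_one \<sigma>_mult that]
    by (simp_all add: \<Phi>_def)
  \<comment> \<open>The unit of the group ring is \<open>gr_of\<close> of a zeroth power of a
    generator, hence the instance \<open>i = 0\<close>.\<close>
  have \<Phi>_one: "\<Phi> 1 = 1\<^sub>m 3"
    using pow(1)[of 0 q 0] assms(11) by (simp add: c h_def carrier_matD[OF \<sigma>_carrier])
  \<comment> \<open>Treats both generators at once: \<open>(b, e, m)\<close> will be
    \<open>(0, q, p)\<close> for c and \<open>(1, p, q)\<close> for d.\<close>
  have main: "\<Phi> (1 - gr_of (gen b)) = 1\<^sub>m 3 - rat_t ^ e \<cdot>\<^sub>m h (\<sigma> (pres_class 2 [R] (gen b)))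
      \<and> det (\<Phi> (\<Sum>i<m. gr_of (gen b [^]\<^bsub>?Fr\<^esub> i))) * det (\<Phi> (1 - gr_of (gen b))) = (1 - rat_t ^ (e * m)) ^ 3"
    if b: "b < 2" and e: "f (pres_class 2 [R] (gen b)) = int e"
      and one: "\<sigma> (pres_class 2 [R] (gen b) [^]\<^bsub>?G\<^esub> m) = 1\<^sub>m 3" for b e m
  proof -
    define A where "A = rat_t ^ e \<cdot>\<^sub>m h (\<sigma> (pres_class 2 [R] (gen b)))"
    note pow = pow[OF b e]
    have A: "A \<in> carrier_mat 3 3" by (simp add: A_def h_def \<sigma>_carrier)
    have "\<Phi> (gr_of (gen b)) = A" using pow(1)[of 1] A by (simp add: A_def)
    then have diff: "\<Phi> (1 - gr_of (gen b)) = 1\<^sub>m 3 - A"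
      using \<Phi>_one by (simp add: \<Phi>_def wada_Phi_diff)
    have "\<Phi> (\<Sum>i<m. gr_of (gen b [^]\<^bsub>?Fr\<^esub> i)) = mat 3 3 (\<lambda>ij. \<Sum>i<m. (A ^\<^sub>m i) $$ ij)"
      using pow(1) by (simp add: \<Phi>_def wada_Phi_sum A_def)
    then have "\<Phi> (\<Sum>i<m. gr_of (gen b [^]\<^bsub>?Fr\<^esub> i)) * \<Phi> (1 - gr_of (gen b)) = 1\<^sub>m 3 - A ^\<^sub>m m"
      using geometric_mat_sum[OF A] by (simp add: diff)
    \<comment> \<open>The power of t splits off as a scalar; what remains is \<sigma> of the
      \<open>m\<close>-th power of the generator, the identity by \<open>one\<close>.\<close>
    also have "A ^\<^sub>m m = rat_t ^ (e * m) \<cdot>\<^sub>m 1\<^sub>m 3"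
      using pow(2)[of m, symmetric] unfolding one
      by (simp add: A_def h_def pow_mat_smult[of _ 3] \<sigma>_carrier power_mult rat_const_hom.mat_hom_one
          flip: rat_const_hom.mat_hom_pow[OF \<sigma>_carrier])
    finally have "det (\<Phi> (\<Sum>i<m. gr_of (gen b [^]\<^bsub>?Fr\<^esub> i))) * det (\<Phi> (1 - gr_of (gen b))) =
        det (1\<^sub>m 3 - rat_t ^ (e * m) \<cdot>\<^sub>m 1\<^sub>m 3 :: ratfun mat)"
      by (subst det_mult[symmetric, of _ 3]) (simp_all add: \<Phi>_def)
    then show ?thesis using diff by (simp add: A_def det_one_minus_smult_one)
  qed
  have scalar: "\<sigma> x = 1\<^sub>m 3" if "x \<in> carrier ?G" "\<rho> x = z \<cdot>\<^sub>m 1\<^sub>m 2" for x z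
    using Ad_mat_scalar[OF basis, of z] \<rho>.hom_closed[OF that(1)] that(2) by (simp add: \<sigma>_def)
  \<comment> \<open>Rewrites the coefficient (tr A)^2 - 2 of the characteristic formula as the
    cosine of the doubled angle.\<close>
  have double_angle: "complex_of_real (2 * cos (pi * u / v)) ^ 2 - 2 = complex_of_real (2 * cos (2 * pi * u / v))" for u v :: real
  proof -
    have "(2 * cos (pi * u / v)) ^ 2 - 2 = 2 * cos (2 * pi * u / v)"
      using cos_double_cos[of "pi * u / v"] by (simp add: power_mult_distrib mult.assoc)
    then show ?thesis by (metis of_real_diff of_real_numeral of_real_power)
  qed
  have char: "det (1\<^sub>m 3 - x \<cdot>\<^sub>m h (\<sigma> g)) = (1 - x) * (x^2 - rat_const (complex_of_real (2 * cos (2 * pi * u / v))) * x + 1)"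
    if "g \<in> carrier ?G" "mat_trace (\<rho> g) = complex_of_real (2 * cos (pi * u / v))" for g x u v
    using char_Ad_mat[OF basis \<rho>.hom_closed[OF that(1)], of x]
    unfolding that(2) double_angle by (simp add: \<sigma>_def h_def)

  \<comment> \<open>Determinants attached to the two generators\<close>
  note main_c = main[of 0 q p, folded c, OF _ assms(11) scalar[OF G.nat_pow_closed[OF cd_in(1)] \<rho>_cd(1)]]
  note main_d = main[of 1 p q, folded d, OF _ assms(12) scalar[OF G.nat_pow_closed[OF cd_in(2)] \<rho>_cd(2)]]
  define x y where "x = rat_t ^ q" and "y = rat_t ^ p"
  define Qc where "Qc = x^2 - rat_const (complex_of_real (2 * cos (2 * pi * real k / real p))) * x + 1"
  define Qd where "Qd = y^2 - rat_const (complex_of_real (2 * cos (2 * pi * real l / real q))) * y + 1"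
  define Sc where "Sc = (\<Sum>i<p. gr_of (gen (0::nat) [^]\<^bsub>?Fr\<^esub> i))"
  define Sd where "Sd = (\<Sum>i<q. gr_of (gen (1::nat) [^]\<^bsub>?Fr\<^esub> i))"
  have det_c: "det (\<Phi> (1 - gr_of (gen 0))) = (1 - x) * Qc"
    and det_d: "det (\<Phi> (1 - gr_of (gen 1))) = (1 - y) * Qd"
    using main_c main_d char[OF cd_in(1) \<rho>_cd(3)] char[OF cd_in(2) \<rho>_cd(4)]
    by (simp_all add: x_def y_def Qc_def Qd_def)
  define T where "T = rat_t ^ (p * q)"
  have Sc: "det (\<Phi> Sc) * ((1 - x) * Qc) = (1 - T) ^ 3" and Sd: "det (\<Phi> Sd) * ((1 - y) * Qd) = (1 - T) ^ 3"
    using main_c main_d by (simp_all add: det_c det_d Sc_def Sd_def T_def mult.commute del: One_nat_def)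
  have "T \<noteq> 1" using assms(1,2) by (simp add: T_def rat_t_power_neq_1)
  \<comment> \<open>Each of these is a factor of the nonzero cube
    \<open>(1 - T) ^ 3\<close>.\<close>
  then have nz: "(1 - x) * Qc \<noteq> 0" "(1 - y) * Qd \<noteq> 0" using Sc Sd by auto
  have det_Sc: "det (\<Phi> Sc) = (1 - T) ^ 3 / ((1 - x) * Qc)"
    and det_Sd: "det (\<Phi> Sd) = (1 - T) ^ 3 / ((1 - y) * Qd)"
    using nz Sc Sd by (simp_all only: eq_divide_eq not_False_eq_True if_True)

  \<comment> \<open>Fox derivatives of the relator\<close>
  have fox_c: "fox 0 R = Sc"
    by (simp add: R_def Sc_def fox_add fox_uminus fox_gen_pow diff_conv_add_uminus del: add_uminus_conv_diff)
  \<comment> \<open>The product rule contributes the prefix c^p and \<open>fox_uminus\<close> the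
    factor d^-q; together they form \<open>R\<close>.\<close>
  have fox_d: "fox 1 R = - (gr_of R * Sd)"
    by (simp add: R_def Sd_def fox_add fox_uminus fox_gen_pow mult_single diff_conv_add_uminus
        flip: mult.assoc del: add_uminus_conv_diff)
  have "\<Phi> (gr_of R * Sd) = \<Phi> Sd"
  proof -
    have "\<Phi> (gr_of (R + gen 1 [^]\<^bsub>?Fr\<^esub> i)) = \<Phi> (gr_of (gen 1 [^]\<^bsub>?Fr\<^esub> i))" for i :: nat
      using Fr.nat_pow_closed[OF gen(2)]
      by (simp add: \<Phi>_def wada_Phi_gr_of \<sigma>_carrier pres_class_relator_add[OF rs])
    then show ?thesis
      by (simp add: Sd_def sum_distrib_left mult_single) (simp add: \<Phi>_def wada_Phi_sum)
  qed
  then have "\<Phi> (fox 1 R) = (- 1) \<cdot>\<^sub>m \<Phi> Sd"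
    unfolding fox_d by (auto simp: \<Phi>_def wada_Phi_uminus intro!: eq_matI)
  \<comment> \<open>The block has odd size 3, so the sign of the derivative passes to the
    determinant.\<close>
  then have det_fox_d: "det (\<Phi> (fox 1 R)) = - det (\<Phi> Sd)" by (simp add: \<Phi>_def)

  \<comment> \<open>The two quotients and their signs\<close>
  let ?\<Delta> = "twisted_alexander 3 2 [R] f \<sigma>"
  let ?F = "(T - 1) ^ 3 / ((y - 1) * (x - 1) * Qc * Qd)"
  \<comment> \<open>This sign cancels that of \<open>det_fox_d\<close> in \<open>?\<Delta> 0\<close>
    and survives in \<open>?\<Delta> 1\<close>.\<close>
  have cube: "(1 - T) ^ 3 = - ((T - 1) ^ 3)" by (simp add: power3_eq_cube algebra_simps)
  have denom: "(y - 1) * (x - 1) * Qc * Qd = (1 - y) * Qd * ((1 - x) * Qc)"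
    by (simp add: algebra_simps)
  have "?\<Delta> 0 = - det (\<Phi> Sd) / ((1 - x) * Qc)"
    using det_fox_d det_c by (simp add: twisted_alexander_def remove_block_col_wada_M \<Phi>_def)
  also have "\<dots> = - ((1 - T) ^ 3 / ((1 - y) * Qd)) / ((1 - x) * Qc)"
    by (simp only: det_Sd)
  also have "\<dots> = ?F"
    by (simp only: cube denom divide_divide_eq_left minus_divide_left[symmetric] minus_minus)
  finally have \<Delta>0: "?\<Delta> 0 = ?F" .
  have "?\<Delta> 1 = det (\<Phi> Sc) / ((1 - y) * Qd)"
    using det_d fox_c by (simp add: twisted_alexander_def remove_block_col_wada_M \<Phi>_def)
  also have "\<dots> = ((1 - T) ^ 3 / ((1 - x) * Qc)) / ((1 - y) * Qd)"
    by (simp only: det_Sc)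
  also have "\<dots> = - ?F"
    by (simp only: cube denom mult.commute[of "(1 - y) * Qd"] divide_divide_eq_left minus_divide_left[symmetric] minus_minus)
  finally have \<Delta>1: "?\<Delta> 1 = - ?F" .
  \<comment> \<open>Both equalities hold exactly, so the exponent \<open>m\<close> is 0.\<close>
  have refl: "P = Q \<Longrightarrow> eq_upto_tN 3 P Q" for P Q
    unfolding eq_upto_tN_def by (intro exI[of _ 0]) simp
  have squares: "rat_t ^ (2 * q) = x^2" "rat_t ^ (2 * p) = y^2"
    by (simp_all add: x_def y_def mult.commute flip: power_mult)
  show ?thesis
    unfolding Let_def rels \<sigma>_def[symmetric] squares x_def[symmetric] y_def[symmetric] T_def[symmetric]
      Qc_def[symmetric] Qd_def[symmetric]
    by (intro conjI refl \<Delta>0 \<Delta>1)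
qed

end
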